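(* Let $\mathcal{V}$ be a variety with a weak $f$-term and $\mathbf{A}\in\mathcal{V}$. Let $n\ge 2$ and $\theta,\theta_1,\dots,\theta_n\in\mathrm{Con}\,\mathbf{A}$ be such that $f(\theta)\leq[\theta_1,\dots,\theta_n]\leq\theta_1\vee\cdots\vee\theta_n\leq\theta$. (1) For any $\gamma\in\mathrm{Con}\,\mathbf{A}$, $\mathbf{A}\vDash C(\theta_1,\dots,\theta_n;\gamma)$ if and only if $[\theta_1,\dots,\theta_n]\leq\gamma$. (2) If $\eta\in\mathrm{Con}\,\mathbf{A}$ and $\eta\leq\theta_1\wedge\cdots\wedge\theta_n$, then $$[\theta_1/\eta,\dots,\theta_n/\eta]=([\theta_1,\dots,\theta_n]\vee\eta)/\eta,$$ where the commutator on the left side is computed in the quotient algebra $\mathbf{A}/\eta$.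
   Context: Higher commutator. For congruences $\alpha_1,\dots,\alpha_n,\delta$ of an algebra $\mathbf{A}$ ($n\ge 2$), $\mathbf{A}\vDash C(\alpha_1,\dots,\alpha_n;\delta)$ holds if for all polynomials $g(\mathbf{x}_1,\dots,\mathbf{x}_n)$ of $\mathbf A$ in $n$ blocks of variables and all tuples with $\mathbf{a}_i\equiv_{\alpha_i}\mathbf{b}_i$ (coordinatewise, $i\le n$): if $g(\mathbf{z}_1,\dots,\mathbf{z}_{n-1},\mathbf{a}_n)\equiv_\delta g(\mathbf{z}_1,\dots,\mathbf{z}_{n-1},\mathbf{b}_n)$ for every $(\mathbf{z}_1,\dots,\mathbf{z}_{n-1})\in\prod_{i<n}\{\mathbf{a}_i,\mathbf{b}_i\}\setminus\{(\mathbf{b}_1,\dots,\mathbf{b}_{n-1})\}$, then $g(\mathbf{b}_1,\dots,\mathbf{b}_{n-1},\mathbf{a}_n)\equiv_\delta g(\mathbf{b}_1,\dots,\mathbf{b}_{n-1},\mathbf{b}_n)$. $[\alpha_1,\dots,\alpha_n]$ is the least $\delta$ with $C(\alpha_1,\dots,\alpha_n;\delta)$. Weak $f$-terms. Given an algebra $\mathbf{A}$ and an order-preserving map $f:\mathrm{Con}\,\mathbf{A}\to\mathrm{Con}\,\mathbf{A}$, a term $p(x,y,z)$ is a weak $f$-term of $\mathbf{A}$ if for all $\theta\in\mathrm{Con}\,\mathbf{A}$ and $(a,b)\in\theta$, $p(a,b,b)\;f(\theta)\;a\;f(\theta)\;p(b,b,a)$. A term is a weak $f$-term for a variety $\mathcal{V}$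 if for each algebra in $\mathcal{V}$ there is an interpretation of $f$ as an order-preserving map on its congruence lattice such that the term is a weak $f$-term of that algebra. *)

theory Defs
  imports Main
begin

text \<open>
  A signature is a partial map \<open>sg\<close> from operation symbols to (finite) arities; its
  domain is the set of symbols, so the empty signature is included.
\<close>

record ('f, 'a) algebra =
  carrier :: "'a set"
  interp :: "'f \<Rightarrow> 'a list \<Rightarrow> 'a"

definition is_algebra :: "('f \<rightharpoonup> nat) \<Rightarrow> ('f, 'a) algebra \<Rightarrow> bool" where
  "is_algebra sg A \<longleftrightarrow> carrier A \<noteq> {} \<and>
     (\<forall>h xs. sg h = Some (length xs) \<and> set xs \<subseteq> carrier A \<longrightarrow> interp A h xs \<in> carrier A)"


section \<open>Terms and varieties\<close>

datatype (vars: 'v, 'f) trm = Var 'v | App 'f "('v, 'f) trm list"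

fun wf_trm :: "('f \<rightharpoonup> nat) \<Rightarrow> ('v, 'f) trm \<Rightarrow> bool" where
  "wf_trm sg (Var x) \<longleftrightarrow> True"
| "wf_trm sg (App h ts) \<longleftrightarrow> sg h = Some (length ts) \<and> (\<forall>t\<in>set ts. wf_trm sg t)"

fun eval :: "('f, 'a) algebra \<Rightarrow> ('v \<Rightarrow> 'a) \<Rightarrow> ('v, 'f) trm \<Rightarrow> 'a" where
  "eval A \<rho> (Var x) = \<rho> x"
| "eval A \<rho> (App h ts) = interp A h (map (eval A \<rho>) ts)"

definition models :: "('f \<rightharpoonup> nat) \<Rightarrow> ((nat, 'f) trm \<times> (nat, 'f) trm) set \<Rightarrow> ('f, 'a) algebra set" where
  "models sg E = {A. is_algebra sg A \<and>
     (\<forall>(s, t)\<in>E. \<forall>\<rho>. range \<rho> \<subseteq> carrier A \<longrightarrow> eval A \<rho> s = eval A \<rho> t)}"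

text \<open>
  A variety is an equational class. As there is no quantification over types, \<open>V\<close> collects
  the members of the class whose carrier is a subset of the type \<open>'a\<close>.
\<close>

definition variety :: "('f \<rightharpoonup> nat) \<Rightarrow> ('f, 'a) algebra set \<Rightarrow> bool" where
  "variety sg V \<longleftrightarrow>
     (\<exists>E. (\<forall>(s, t)\<in>E. wf_trm sg s \<and> wf_trm sg t) \<and> V = models sg E)"


section \<open>Congruences and quotients\<close>

definition Con :: "('f \<rightharpoonup> nat) \<Rightarrow> ('f, 'a) algebra \<Rightarrow> 'a rel set" where
  "Con sg A = {\<theta>. equiv (carrier A) \<theta> \<and>
     (\<forall>h xs ys. sg h = Some (length xs) \<and> list_all2 (\<lambda>x y. (x, y) \<in> \<theta>) xs ys
        \<longrightarrow> (interp A h xs, interp A h ys) \<in> \<theta>)}"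

text \<open>
  \<open>Con sg A\<close> is ordered by inclusion and its meets are intersections; joins are least upper
  bounds within \<open>Con sg A\<close>.
\<close>

definition con_join :: "('f \<rightharpoonup> nat) \<Rightarrow> ('f, 'a) algebra \<Rightarrow> 'a rel set \<Rightarrow> 'a rel" where
  "con_join sg A \<Theta> = \<Inter>{\<delta> \<in> Con sg A. \<forall>\<theta>\<in>\<Theta>. \<theta> \<subseteq> \<delta>}"

text \<open>
  For a congruence \<open>\<eta>\<close> all the classes in the union below coincide, so the value is the
  class of the operation applied to arbitrary representatives.
\<close>

definition quotient_algebra :: "('f, 'a) algebra \<Rightarrow> 'a rel \<Rightarrow> ('f, 'a set) algebra" where
  "quotient_algebra A \<eta> = \<lparr>carrier = carrier A // \<eta>,
     interp = (\<lambda>h Xs. \<Union>xs\<in>listset Xs. \<eta> `` {interp A h xs})\<rparr>"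

definition quotient_con :: "'a rel \<Rightarrow> 'a rel \<Rightarrow> 'a set rel" where
  "quotient_con \<theta> \<eta> = {(\<eta> `` {x}, \<eta> `` {y}) | x y. (x, y) \<in> \<theta>}"


section \<open>Higher commutator\<close>

text \<open>
  A polynomial in \<open>n\<close> blocks of variables, the \<open>i\<close>-th of length \<open>k i\<close> (\<open>1 \<le> i \<le> n\<close>), is a
  term over two kinds of variables: \<open>Inl (i, j)\<close> stands for the \<open>j\<close>-th variable (from 0) of
  the \<open>i\<close>-th block, \<open>Inr c\<close> for the constant \<open>c\<close> of the algebra.
\<close>

definition polys :: "('f \<rightharpoonup> nat) \<Rightarrow> ('f, 'a) algebra \<Rightarrow> nat \<Rightarrow> (nat \<Rightarrow> nat)
    \<Rightarrow> ((nat \<times> nat) + 'a, 'f) trm set" where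
  "polys sg A n k = {g. wf_trm sg g \<and>
     vars g \<subseteq> Inl ` {(i, j). i \<in> {1..n} \<and> j < k i} \<union> Inr ` carrier A}"

definition eval_poly :: "('f, 'a) algebra \<Rightarrow> ((nat \<times> nat) + 'a, 'f) trm \<Rightarrow> (nat \<Rightarrow> 'a list) \<Rightarrow> 'a" where
  "eval_poly A g z = eval A (case_sum (\<lambda>(i, j). z i ! j) (\<lambda>c. c)) g"

definition select :: "nat set \<Rightarrow> (nat \<Rightarrow> 'b) \<Rightarrow> (nat \<Rightarrow> 'b) \<Rightarrow> nat \<Rightarrow> 'b" where
  "select S a b i = (if i \<in> S then b i else a i)"

text \<open>
  The tuples \<open>(z\<^sub>1, \<dots>, z\<^sub>n\<^sub>-\<^sub>1)\<close> are indexed by the set \<open>S\<close> of those \<open>i\<close> with \<open>z\<^sub>i = b\<^sub>i\<close>, and only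
  \<open>S = {1..<n}\<close> is excluded. So the choice of \<open>a\<^sub>i\<close> and that of \<open>b\<^sub>i\<close> count as different even
  if \<open>a\<^sub>i = b\<^sub>i\<close>; otherwise the premise would be vacuous when \<open>a\<^sub>i = b\<^sub>i\<close> for all \<open>i < n\<close>.
\<close>

definition centralizes ::
  "('f \<rightharpoonup> nat) \<Rightarrow> ('f, 'a) algebra \<Rightarrow> nat \<Rightarrow> (nat \<Rightarrow> 'a rel) \<Rightarrow> 'a rel \<Rightarrow> bool" where
  "centralizes sg A n \<alpha> \<delta> \<longleftrightarrow>
     (\<forall>k. \<forall>g\<in>polys sg A n k. \<forall>a b.
        (\<forall>i\<in>{1..n}. length (a i) = k i \<and> length (b i) = k i \<and>
                     list_all2 (\<lambda>x y. (x, y) \<in> \<alpha> i) (a i) (b i)) \<longrightarrow>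
        (\<forall>S. S \<subset> {1..<n} \<longrightarrow>
           (eval_poly A g ((select S a b)(n := a n)),
            eval_poly A g ((select S a b)(n := b n))) \<in> \<delta>) \<longrightarrow>
        (eval_poly A g (b(n := a n)), eval_poly A g b) \<in> \<delta>)"

definition commutator ::
  "('f \<rightharpoonup> nat) \<Rightarrow> ('f, 'a) algebra \<Rightarrow> nat \<Rightarrow> (nat \<Rightarrow> 'a rel) \<Rightarrow> 'a rel" where
  "commutator sg A n \<alpha> = (LEAST \<delta>. \<delta> \<in> Con sg A \<and> centralizes sg A n \<alpha> \<delta>)"


section \<open>Weak f-terms\<close>

definition order_preserving :: "('f \<rightharpoonup> nat) \<Rightarrow> ('f, 'a) algebra \<Rightarrow> ('a rel \<Rightarrow> 'a rel) \<Rightarrow> bool" where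
  "order_preserving sg A f \<longleftrightarrow> f ` Con sg A \<subseteq> Con sg A \<and> mono_on (Con sg A) f"

definition eval3 :: "('f, 'a) algebra \<Rightarrow> (nat, 'f) trm \<Rightarrow> 'a \<Rightarrow> 'a \<Rightarrow> 'a \<Rightarrow> 'a" where
  "eval3 A p x y z = eval A ((!) [x, y, z]) p"

definition weak_term ::
  "('f \<rightharpoonup> nat) \<Rightarrow> ('f, 'a) algebra \<Rightarrow> ('a rel \<Rightarrow> 'a rel) \<Rightarrow> (nat, 'f) trm \<Rightarrow> bool" where
  "weak_term sg A f p \<longleftrightarrow> wf_trm sg p \<and> vars p \<subseteq> {0, 1, 2} \<and>
     (\<forall>\<theta>\<in>Con sg A. \<forall>(a, b)\<in>\<theta>.
        (eval3 A p a b b, a) \<in> f \<theta> \<and> (a, eval3 A p b b a) \<in> f \<theta>)"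

text \<open>Here \<open>f B\<close> is the interpretation of the symbol \<open>f\<close> on the congruence lattice of \<open>B\<close>.\<close>

definition variety_weak_term ::
  "('f \<rightharpoonup> nat) \<Rightarrow> ('f, 'a) algebra set \<Rightarrow> (('f, 'a) algebra \<Rightarrow> 'a rel \<Rightarrow> 'a rel)
     \<Rightarrow> (nat, 'f) trm \<Rightarrow> bool" where
  "variety_weak_term sg V f p \<longleftrightarrow>
     (\<forall>B\<in>V. order_preserving sg B (f B) \<and> weak_term sg B (f B) p)"

end

theory Submission
  imports Defs
begin

text \<open>
  Write \<open>\<kappa>\<close> for the commutator of the given congruences \<open>\<alpha>\<^sub>1, \<dots>, \<alpha>\<^sub>n\<close>. Since \<open>\<kappa>\<close> is the least
  congruence that the tuple centralizes, one direction of the first claim is immediate; the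
  other says that centrality passes from \<open>\<kappa>\<close> to every larger congruence \<open>\<gamma>\<close>. The definition
  does not give this, because a larger \<open>\<gamma>\<close> weakens the premises of the centrality condition
  along with its conclusion. But \<open>\<kappa>\<close> contains \<open>f \<theta>\<close>, so modulo \<open>\<kappa>\<close> the term \<open>p\<close> is a Mal'cev
  operation on every \<open>\<theta>\<close>-class, and that suffices to turn premises modulo \<open>\<gamma>\<close> into premises
  modulo \<open>\<kappa>\<close>: replace the polynomial \<open>g\<close> by
    \<open>g'(z\<^sub>1, \<dots>, z\<^sub>n) = p(g(z), g(z with z\<^sub>i := a\<^sub>i), g(z with z\<^sub>i := a\<^sub>i, z\<^sub>n := a\<^sub>n))\<close>.
  If \<open>z\<^sub>i = a\<^sub>i\<close>, then the first two arguments agree, so \<open>g'(z)\<close> is \<open>\<kappa>\<close>-congruent to a value in which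
  \<open>z\<^sub>n\<close> does not occur: the premises at such \<open>z\<close> now hold modulo \<open>\<kappa>\<close>. On the other hand, at
  \<open>z = b\<close> the values of \<open>g'\<close> and \<open>g\<close> are \<open>\<gamma>\<close>-congruent, both for \<open>z\<^sub>n = a\<^sub>n\<close> and for \<open>z\<^sub>n = b\<^sub>n\<close>, so
  the conclusion for \<open>g'\<close> gives the conclusion for \<open>g\<close>. Doing this for each \<open>i < n\<close> makes all
  premises hold modulo \<open>\<kappa>\<close>, and centrality modulo \<open>\<kappa>\<close> applies. This is lemma
  \<open>centralizes_mono\<close>.

  For the second claim, polynomials and tuples of a quotient algebra lift to representatives, so
  the \<open>\<alpha>\<^sub>i/\<eta>\<close> centralize \<open>\<delta>/\<eta>\<close> if and only if the \<open>\<alpha>\<^sub>i\<close> centralize \<open>\<delta>\<close>, for every congruence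
  \<open>\<delta> \<supseteq> \<eta>\<close> (lemma \<open>centralizes_quotient_iff\<close>). By the first claim this holds exactly when \<open>\<delta>\<close>
  contains \<open>\<kappa>\<close>. Since every congruence of the quotient is such a \<open>\<delta>/\<eta>\<close>, the least one that is
  centralized is the image of the join of \<open>\<kappa>\<close> and \<open>\<eta>\<close>.
\<close>


section \<open>Terms, polynomials and congruences\<close>

lemma ConD:
  assumes "\<theta> \<in> Con sg A"
  shows "equiv (carrier A) \<theta>"
    and "sg h = Some (length xs) \<Longrightarrow> list_all2 (\<lambda>x y. (x, y) \<in> \<theta>) xs ys \<Longrightarrow>
      (interp A h xs, interp A h ys) \<in> \<theta>"
  using assms by (auto simp: Con_def)

lemma Con_refl: "\<theta> \<in> Con sg A \<Longrightarrow> x \<in> carrier A \<Longrightarrow> (x, x) \<in> \<theta>"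
  by (meson ConD(1) equivE refl_onD)

lemma Con_sym: "\<theta> \<in> Con sg A \<Longrightarrow> (x, y) \<in> \<theta> \<Longrightarrow> (y, x) \<in> \<theta>"
  by (meson ConD(1) equivE symD)

lemma Con_trans: "\<theta> \<in> Con sg A \<Longrightarrow> (x, y) \<in> \<theta> \<Longrightarrow> (y, z) \<in> \<theta> \<Longrightarrow> (x, z) \<in> \<theta>"
  by (meson ConD(1) equivE transD)

lemma Con_common_right:
  assumes "\<theta> \<in> Con sg A" "(x, z) \<in> \<theta>" "(y, z) \<in> \<theta>"
  shows "(x, y) \<in> \<theta>"
  using Con_trans[OF assms(1,2) Con_sym[OF assms(1,3)]] .

lemma Con_carrier: "\<theta> \<in> Con sg A \<Longrightarrow> (x, y) \<in> \<theta> \<Longrightarrow> x \<in> carrier A \<and> y \<in> carrier A"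
  using ConD(1) equiv_type by fastforce

lemma Con_subset: "\<theta> \<in> Con sg A \<Longrightarrow> \<theta> \<subseteq> carrier A \<times> carrier A"
  using Con_carrier by fast

lemma Con_lists_carrier:
  assumes "\<theta> \<in> Con sg A" "list_all2 (\<lambda>x y. (x, y) \<in> \<theta>) xs ys"
  shows "set xs \<subseteq> carrier A" "set ys \<subseteq> carrier A"
  using assms(2) by (induction rule: list_all2_induct) (auto dest: Con_carrier[OF assms(1)])

lemma full_relation_in_Con:
  assumes "is_algebra sg A"
  shows "carrier A \<times> carrier A \<in> Con sg A"
proof -
  have "interp A h xs \<in> carrier A \<and> interp A h ys \<in> carrier A"
    if "sg h = Some (length xs)"
      "list_all2 (\<lambda>x y. (x, y) \<in> carrier A \<times> carrier A) xs ys" for h xs ys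
  proof -
    from that(2) have "set xs \<subseteq> carrier A" "set ys \<subseteq> carrier A" "length ys = length xs"
      by (auto simp: list_all2_conv_all_nth in_set_conv_nth)
    with that(1) assms show ?thesis by (auto simp: is_algebra_def)
  qed
  moreover have "equiv (carrier A) (carrier A \<times> carrier A)"
    by (auto intro!: equivI refl_onI symI transI)
  ultimately show ?thesis by (auto simp: Con_def)
qed

lemma Inter_in_Con:
  assumes "D \<subseteq> Con sg A" "D \<noteq> {}"
  shows "\<Inter>D \<in> Con sg A"
proof -
  have "equiv (carrier A) (\<Inter>D)"
  proof (rule equivI)
    show "\<Inter>D \<subseteq> carrier A \<times> carrier A"
      using assms(2) subsetD[OF assms(1), THEN Con_subset] by blast
    show "refl_on (carrier A) (\<Inter>D)"
      using subsetD[OF assms(1), THEN Con_refl] by (intro refl_onI) blast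
    show "sym (\<Inter>D)"
      using subsetD[OF assms(1), THEN Con_sym] by (intro symI) blast
    show "trans (\<Inter>D)"
      using subsetD[OF assms(1), THEN Con_trans] by (intro transI) blast
  qed
  moreover have "(interp A h xs, interp A h ys) \<in> \<Inter>D"
    if "sg h = Some (length xs)" "list_all2 (\<lambda>x y. (x, y) \<in> \<Inter>D) xs ys" for h xs ys
  proof
    fix \<delta> assume "\<delta> \<in> D"
    then have "list_all2 (\<lambda>x y. (x, y) \<in> \<delta>) xs ys"
      using that(2) by (auto elim: list_all2_mono)
    with \<open>\<delta> \<in> D\<close> show "(interp A h xs, interp A h ys) \<in> \<delta>"
      by (intro ConD(2)[OF subsetD[OF assms(1)] that(1)])
  qed
  ultimately show ?thesis by (auto simp: Con_def)
qed

lemma con_join_in_Con: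
  assumes "is_algebra sg A" "\<Theta> \<subseteq> Con sg A"
  shows "con_join sg A \<Theta> \<in> Con sg A"
  unfolding con_join_def
proof (rule Inter_in_Con)
  have "carrier A \<times> carrier A \<in> {\<delta> \<in> Con sg A. \<forall>\<theta>\<in>\<Theta>. \<theta> \<subseteq> \<delta>}"
    using full_relation_in_Con[OF assms(1)] subsetD[OF assms(2), THEN Con_subset] by blast
  then show "{\<delta> \<in> Con sg A. \<forall>\<theta>\<in>\<Theta>. \<theta> \<subseteq> \<delta>} \<noteq> {}" by blast
qed blast

lemma eval_cong: "(\<And>x. x \<in> vars t \<Longrightarrow> \<rho> x = \<sigma> x) \<Longrightarrow> eval A \<rho> t = eval A \<sigma> t"
proof (induction t)
  case (App h ts)
  then have "map (eval A \<rho>) ts = map (eval A \<sigma>) ts" by auto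
  then show ?case by (simp only: eval.simps)
qed simp

lemma eval_congruent:
  assumes "\<theta> \<in> Con sg A" "wf_trm sg t" "\<And>x. x \<in> vars t \<Longrightarrow> (\<rho> x, \<sigma> x) \<in> \<theta>"
  shows "(eval A \<rho> t, eval A \<sigma> t) \<in> \<theta>"
  using assms(2,3)
proof (induction t)
  case (App h ts)
  have "list_all2 (\<lambda>x y. (x, y) \<in> \<theta>) (map (eval A \<rho>) ts) (map (eval A \<sigma>) ts)"
    unfolding list.rel_map by (rule list.rel_refl_strong) (use App in auto)
  with App.prems(1) show ?case using ConD(2)[OF assms(1)] by simp
qed simp

text \<open>
  Reflexivity of any one congruence and compatibility with the operations already force closure
  of the carrier.
\<close>

lemma eval_closed:
  assumes "\<theta> \<in> Con sg A" "wf_trm sg t" "\<And>x. x \<in> vars t \<Longrightarrow> \<rho> x \<in> carrier A"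
  shows "eval A \<rho> t \<in> carrier A"
  using eval_congruent[OF assms(1,2), of \<rho> \<rho>] Con_refl[OF assms(1)] assms(3)
    Con_carrier[OF assms(1)] by blast

lemma eval3_congruent:
  assumes "\<theta> \<in> Con sg A" "wf_trm sg p" "vars p \<subseteq> {0, 1, 2}"
    and "(u, u') \<in> \<theta>" "(v, v') \<in> \<theta>" "(w, w') \<in> \<theta>"
  shows "(eval3 A p u v w, eval3 A p u' v' w') \<in> \<theta>"
  unfolding eval3_def using assms(3-) by (intro eval_congruent[OF assms(1,2)]) auto

lemma eval_poly_cong:
  assumes "g \<in> polys sg A n k" "\<And>i. i \<in> {1..n} \<Longrightarrow> z i = w i"
  shows "eval_poly A' g z = eval_poly A' g w"
  unfolding eval_poly_def using assms
  by (intro eval_cong) (fastforce simp: polys_def split: sum.splits)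

lemma eval_poly_congruent:
  assumes "\<theta> \<in> Con sg A" "g \<in> polys sg A n k"
    and "\<And>i. i \<in> {1..n} \<Longrightarrow> length (z i) = k i"
    and "\<And>i. i \<in> {1..n} \<Longrightarrow> list_all2 (\<lambda>x y. (x, y) \<in> \<theta>) (z i) (w i)"
  shows "(eval_poly A g z, eval_poly A g w) \<in> \<theta>"
  unfolding eval_poly_def
proof (rule eval_congruent[OF assms(1)])
  show "wf_trm sg g" using assms(2) by (simp add: polys_def)
  fix x assume "x \<in> vars g"
  then have "x \<in> Inl ` {(i, j). i \<in> {1..n} \<and> j < k i} \<union> Inr ` carrier A"
    using assms(2) by (auto simp: polys_def)
  then show "(case_sum (\<lambda>(i, j). z i ! j) (\<lambda>c. c) x, case_sum (\<lambda>(i, j). w i ! j) (\<lambda>c. c) x) \<in> \<theta>"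
    using assms(3,4) Con_refl[OF assms(1)] by (auto simp: list_all2_conv_all_nth)
qed

text \<open>
  Replacing a variable by a compound term is needed to insert polynomials into \<open>p\<close>; replacing
  variables by variables covers freezing a block at constants and changing the constants.
\<close>

fun subst :: "('v \<Rightarrow> ('w, 'f) trm) \<Rightarrow> ('v, 'f) trm \<Rightarrow> ('w, 'f) trm" where
  "subst \<sigma> (Var x) = \<sigma> x"
| "subst \<sigma> (App h ts) = App h (map (subst \<sigma>) ts)"

lemma eval_subst: "eval A \<rho> (subst \<sigma> t) = eval A (\<lambda>x. eval A \<rho> (\<sigma> x)) t"
proof (induction t)
  case (App h ts)
  then have "map (eval A \<rho> \<circ> subst \<sigma>) ts = map (eval A (\<lambda>x. eval A \<rho> (\<sigma> x))) ts" by auto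
  then show ?case by (simp del: map_eq_conv)
qed simp

lemma wf_subst: "wf_trm sg t \<Longrightarrow> (\<And>x. x \<in> vars t \<Longrightarrow> wf_trm sg (\<sigma> x)) \<Longrightarrow> wf_trm sg (subst \<sigma> t)"
  by (induction t) auto

lemma vars_subst: "vars (subst \<sigma> t) = (\<Union>x\<in>vars t. vars (\<sigma> x))"
  by (induction t) auto

lemma subst_subst: "subst \<sigma> (subst \<tau> t) = subst (\<lambda>x. subst \<sigma> (\<tau> x)) t"
  by (induction t) auto

lemma subst_Var: "(\<And>x. x \<in> vars t \<Longrightarrow> \<sigma> x = Var x) \<Longrightarrow> subst \<sigma> t = t"
  by (induction t) (auto intro: map_idI)

abbreviation map_vars :: "('v \<Rightarrow> 'w) \<Rightarrow> ('v, 'f) trm \<Rightarrow> ('w, 'f) trm" where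
  "map_vars \<phi> \<equiv> subst (\<lambda>x. Var (\<phi> x))"

lemma eval_map_vars: "eval A \<rho> (map_vars \<phi> t) = eval A (\<lambda>x. \<rho> (\<phi> x)) t"
  by (simp add: eval_subst)

lemma wf_map_vars: "wf_trm sg t \<Longrightarrow> wf_trm sg (map_vars \<phi> t)"
  by (simp add: wf_subst)

lemma vars_map_vars: "vars (map_vars \<phi> t) = \<phi> ` vars t"
  by (auto simp: vars_subst)

lemma eval3_polys:
  assumes "wf_trm sg p" "vars p \<subseteq> {0, 1, 2}"
    and "u \<in> polys sg A n k" "v \<in> polys sg A n k" "w \<in> polys sg A n k"
  obtains g where "g \<in> polys sg A n k"
    "\<And>z. eval_poly A g z = eval3 A p (eval_poly A u z) (eval_poly A v z) (eval_poly A w z)"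
proof
  let ?\<sigma> = "\<lambda>i::nat. [u, v, w] ! i"
  have \<sigma>: "?\<sigma> x \<in> polys sg A n k" if "x \<in> vars p" for x
    using assms(2-) that by auto
  have "wf_trm sg (subst ?\<sigma> p)"
    by (rule wf_subst[OF assms(1)]) (use \<sigma> in \<open>simp add: polys_def\<close>)
  moreover have "vars (subst ?\<sigma> p) \<subseteq> Inl ` {(i, j). i \<in> {1..n} \<and> j < k i} \<union> Inr ` carrier A"
    unfolding vars_subst by (rule UN_least) (use \<sigma> in \<open>simp add: polys_def\<close>)
  ultimately show "subst ?\<sigma> p \<in> polys sg A n k" by (simp add: polys_def)
  show "eval_poly A (subst ?\<sigma> p) z =
      eval3 A p (eval_poly A u z) (eval_poly A v z) (eval_poly A w z)" for z
    unfolding eval_poly_def eval3_def eval_subst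
    using assms(2) by (intro eval_cong) auto
qed

lemma freeze_polys:
  assumes "g \<in> polys sg A n k" "length xs = k i" "set xs \<subseteq> carrier A"
  obtains g' where "g' \<in> polys sg A n k" "\<And>z. eval_poly A g' z = eval_poly A g (z(i := xs))"
proof
  let ?\<phi> = "\<lambda>x. case x of Inl (i', j) \<Rightarrow> if i' = i then Inr (xs ! j) else x | Inr c \<Rightarrow> x"
  have "?\<phi> x \<in> Inl ` {(i, j). i \<in> {1..n} \<and> j < k i} \<union> Inr ` carrier A" if "x \<in> vars g" for x
  proof -
    have "x \<in> Inl ` {(i, j). i \<in> {1..n} \<and> j < k i} \<union> Inr ` carrier A"
      using assms(1) that by (auto simp: polys_def)
    moreover have "xs ! j \<in> carrier A" if "j < k i" for j
      using assms(2,3) that nth_mem[of j xs] by auto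
    ultimately show ?thesis by auto
  qed
  then show "map_vars ?\<phi> g \<in> polys sg A n k"
    using assms(1) by (auto simp: polys_def wf_map_vars vars_map_vars)
  show "eval_poly A (map_vars ?\<phi> g) z = eval_poly A g (z(i := xs))" for z
    unfolding eval_poly_def eval_map_vars by (rule eval_cong) (auto split: sum.splits)
qed


section \<open>The commutator exists\<close>

lemma centralizesD:
  assumes "centralizes sg A n \<alpha> \<delta>" "g \<in> polys sg A n k"
    and "\<And>i. i \<in> {1..n} \<Longrightarrow> length (a i) = k i"
    and "\<And>i. i \<in> {1..n} \<Longrightarrow> list_all2 (\<lambda>x y. (x, y) \<in> \<alpha> i) (a i) (b i)"
    and "\<And>S. S \<subset> {1..<n} \<Longrightarrow> (eval_poly A g ((select S a b)(n := a n)),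
            eval_poly A g ((select S a b)(n := b n))) \<in> \<delta>"
  shows "(eval_poly A g (b(n := a n)), eval_poly A g b) \<in> \<delta>"
proof -
  have "\<And>i. i \<in> {1..n} \<Longrightarrow> length (b i) = k i"
    using assms(3,4) list_all2_lengthD by metis
  with assms show ?thesis unfolding centralizes_def by blast
qed

lemma centralizesI:
  assumes "\<And>k g a b. g \<in> polys sg A n k \<Longrightarrow>
     (\<And>i. i \<in> {1..n} \<Longrightarrow> length (a i) = k i) \<Longrightarrow>
     (\<And>i. i \<in> {1..n} \<Longrightarrow> length (b i) = k i) \<Longrightarrow>
     (\<And>i. i \<in> {1..n} \<Longrightarrow> list_all2 (\<lambda>x y. (x, y) \<in> \<alpha> i) (a i) (b i)) \<Longrightarrow>
     (\<And>S. S \<subset> {1..<n} \<Longrightarrow> (eval_poly A g ((select S a b)(n := a n)),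
            eval_poly A g ((select S a b)(n := b n))) \<in> \<delta>) \<Longrightarrow>
     (eval_poly A g (b(n := a n)), eval_poly A g b) \<in> \<delta>"
  shows "centralizes sg A n \<alpha> \<delta>"
  unfolding centralizes_def
proof (intro allI ballI impI)
  fix k g a b
  assume "g \<in> polys sg A n k" "\<forall>i\<in>{1..n}. length (a i) = k i \<and> length (b i) = k i \<and>
      list_all2 (\<lambda>x y. (x, y) \<in> \<alpha> i) (a i) (b i)"
    "\<forall>S. S \<subset> {1..<n} \<longrightarrow> (eval_poly A g ((select S a b)(n := a n)),
      eval_poly A g ((select S a b)(n := b n))) \<in> \<delta>"
  then show "(eval_poly A g (b(n := a n)), eval_poly A g b) \<in> \<delta>"
    by (intro assms[of g k a b]) simp_all
qed

lemma centralizes_Inter: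
  assumes "\<And>\<delta>. \<delta> \<in> D \<Longrightarrow> centralizes sg A n \<alpha> \<delta>"
  shows "centralizes sg A n \<alpha> (\<Inter>D)"
proof (rule centralizesI, rule InterI)
  fix k g a b \<delta>
  assume *: "g \<in> polys sg A n k" "\<And>i. i \<in> {1..n} \<Longrightarrow> length (a i) = k i"
    "\<And>i. i \<in> {1..n} \<Longrightarrow> list_all2 (\<lambda>x y. (x, y) \<in> \<alpha> i) (a i) (b i)"
    "\<And>S. S \<subset> {1..<n} \<Longrightarrow> (eval_poly A g ((select S a b)(n := a n)),
            eval_poly A g ((select S a b)(n := b n))) \<in> \<Inter>D" and "\<delta> \<in> D"
  show "(eval_poly A g (b(n := a n)), eval_poly A g b) \<in> \<delta>"
    by (rule centralizesD[OF assms[OF \<open>\<delta> \<in> D\<close>] *(1-3)]) (use *(4) \<open>\<delta> \<in> D\<close> in blast)+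
qed

lemma centralizes_full:
  assumes "is_algebra sg A" "\<And>i. i \<in> {1..n} \<Longrightarrow> \<alpha> i \<in> Con sg A"
  shows "centralizes sg A n \<alpha> (carrier A \<times> carrier A)"
proof (rule centralizesI)
  fix k g a b
  assume *: "g \<in> polys sg A n k" "\<And>i. i \<in> {1..n} \<Longrightarrow> length (a i) = k i"
    "\<And>i. i \<in> {1..n} \<Longrightarrow> length (b i) = k i"
    "\<And>i. i \<in> {1..n} \<Longrightarrow> list_all2 (\<lambda>x y. (x, y) \<in> \<alpha> i) (a i) (b i)"
  have "set (a i) \<subseteq> carrier A \<and> set (b i) \<subseteq> carrier A" if "i \<in> {1..n}" for i
    using Con_lists_carrier[OF assms(2)[OF that] *(4)[OF that]] by blast
  then show "(eval_poly A g (b(n := a n)), eval_poly A g b) \<in> carrier A \<times> carrier A"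
    by (intro eval_poly_congruent[OF full_relation_in_Con[OF assms(1)] *(1)])
      (force simp: list_all2_conv_all_nth *(2,3))+
qed

text \<open>
  The congruences that the tuple centralizes are closed under intersection and include the
  full relation, so the least element in the definition of the commutator exists and has the
  expected properties.
\<close>

lemma
  assumes "is_algebra sg A" "\<And>i. i \<in> {1..n} \<Longrightarrow> \<alpha> i \<in> Con sg A"
  shows commutator_in_Con: "commutator sg A n \<alpha> \<in> Con sg A"
    and commutator_centralizes: "centralizes sg A n \<alpha> (commutator sg A n \<alpha>)"
    and commutator_least:
      "\<delta> \<in> Con sg A \<Longrightarrow> centralizes sg A n \<alpha> \<delta> \<Longrightarrow> commutator sg A n \<alpha> \<subseteq> \<delta>"
proof -
  let ?D = "{\<delta> \<in> Con sg A. centralizes sg A n \<alpha> \<delta>}"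
  have "?D \<noteq> {}" using full_relation_in_Con centralizes_full assms by blast
  then have D: "\<Inter>?D \<in> Con sg A" "centralizes sg A n \<alpha> (\<Inter>?D)"
    by (auto intro!: Inter_in_Con centralizes_Inter)
  have "commutator sg A n \<alpha> = \<Inter>?D"
    unfolding commutator_def by (rule Least_equality) (use D in blast)+
  with D show "commutator sg A n \<alpha> \<in> Con sg A" "centralizes sg A n \<alpha> (commutator sg A n \<alpha>)"
    and "\<delta> \<in> Con sg A \<Longrightarrow> centralizes sg A n \<alpha> \<delta> \<Longrightarrow> commutator sg A n \<alpha> \<subseteq> \<delta>"
    by auto
qed


section \<open>Centrality is inherited by larger congruences\<close>

text \<open>
  As \<open>\<theta>\<close> contains every \<open>\<alpha>\<^sub>i\<close>, all values of a polynomial at the corners \<open>\<Prod>{a\<^sub>i, b\<^sub>i}\<close> lie in one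
  \<open>\<theta>\<close>-class, where \<open>p\<close> is a Mal'cev operation modulo \<open>\<kappa>\<close>. So the passage from \<open>g\<close> to \<open>g'\<close>
  described at the beginning can be made for one block after the other.
\<close>

lemma centralizes_mono:
  assumes "n \<ge> 1" and "\<theta> \<in> Con sg A" "\<And>i. i \<in> {1..n} \<Longrightarrow> \<alpha> i \<subseteq> \<theta>"
    and p: "wf_trm sg p" "vars p \<subseteq> {0, 1, 2}"
    and malcev: "\<And>x y. (x, y) \<in> \<theta> \<Longrightarrow> (eval3 A p x y y, x) \<in> \<kappa>"
      "\<And>x y. (x, y) \<in> \<theta> \<Longrightarrow> (eval3 A p y y x, x) \<in> \<kappa>"
    and \<kappa>: "\<kappa> \<in> Con sg A" "centralizes sg A n \<alpha> \<kappa>"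
    and \<gamma>: "\<gamma> \<in> Con sg A" "\<kappa> \<subseteq> \<gamma>"
  shows "centralizes sg A n \<alpha> \<gamma>"
proof (rule centralizesI)
  fix k g a b
  assume g: "g \<in> polys sg A n k" and len: "\<And>i. i \<in> {1..n} \<Longrightarrow> length (a i) = k i"
    and len_b: "\<And>i. i \<in> {1..n} \<Longrightarrow> length (b i) = k i"
    and ab: "\<And>i. i \<in> {1..n} \<Longrightarrow> list_all2 (\<lambda>x y. (x, y) \<in> \<alpha> i) (a i) (b i)"
  \<comment> \<open>The value of \<open>g\<close> at the corner of the cube \<open>\<Prod>{a\<^sub>i, b\<^sub>i}\<close> given by \<open>S\<close>, with \<open>y\<close> as last block.\<close>
  define e where "e g S y = eval_poly A g ((select S a b)(n := y))" for g S y
  assume "\<And>S. S \<subset> {1..<n} \<Longrightarrow> (eval_poly A g ((select S a b)(n := a n)),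
            eval_poly A g ((select S a b)(n := b n))) \<in> \<gamma>"
  then have prem: "\<And>S. S \<subset> {1..<n} \<Longrightarrow> (e g S (a n), e g S (b n)) \<in> \<gamma>" by (simp add: e_def)
  have top: "e g {1..<n} (a n) = eval_poly A g (b(n := a n))" "e g {1..<n} (b n) = eval_poly A g b"
    if "g \<in> polys sg A n k" for g
    unfolding e_def by (rule eval_poly_cong[OF that]; auto simp: select_def)+
  have \<theta>_ab: "list_all2 (\<lambda>x y. (x, y) \<in> \<theta>) (a i) (b i)" if "i \<in> {1..n}" for i
    using ab[OF that] assms(3)[OF that] by (auto elim: list_all2_mono)
  have block: "list_all2 (\<lambda>x y. (x, y) \<in> \<theta>) u v"
    if "i \<in> {1..n}" "u \<in> {a i, b i}" "v \<in> {a i, b i}" for i u v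
    using \<theta>_ab[OF that(1)] that(2,3) Con_lists_carrier[OF assms(2) \<theta>_ab[OF that(1)]]
      Con_sym[OF assms(2)] Con_refl[OF assms(2)]
    by (auto simp: list_all2_conv_all_nth subset_iff)
  have e_\<theta>: "(e g S y, e g T y') \<in> \<theta>"
    if "g \<in> polys sg A n k" "y \<in> {a n, b n}" "y' \<in> {a n, b n}" for g S T y y'
    unfolding e_def
  proof (rule eval_poly_congruent[OF assms(2) that(1)])
    fix i assume i: "i \<in> {1..n}"
    show "length (((select S a b)(n := y)) i) = k i"
      using i len len_b that by (auto simp: select_def)
    show "list_all2 (\<lambda>x y. (x, y) \<in> \<theta>) (((select S a b)(n := y)) i) (((select T a b)(n := y')) i)"
      using that(2,3) by (intro block[OF i]) (auto simp: select_def)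
  qed
  have carr: "set (a i) \<subseteq> carrier A" if "i \<in> {1..n}" for i
    using Con_lists_carrier[OF assms(2) \<theta>_ab[OF that]] by simp
  \<comment> \<open>Moving to \<open>S - {i}\<close> means replacing block \<open>i\<close> by the constants \<open>a\<^sub>i\<close>.\<close>
  have difference: "\<exists>g' \<in> polys sg A n k. \<forall>S y.
      e g' S y = eval3 A p (e g S y) (e g (S - {i}) y) (e g (S - {i}) (a n))"
    if g: "g \<in> polys sg A n k" and i: "i \<in> {1..<n}" for g i
  proof -
    obtain v where v: "v \<in> polys sg A n k" "\<And>z. eval_poly A v z = eval_poly A g (z(i := a i))"
      using freeze_polys[OF g] len carr i by (metis atLeastAtMost_iff atLeastLessThan_iff less_imp_le)
    obtain w where w: "w \<in> polys sg A n k" "\<And>z. eval_poly A w z = eval_poly A v (z(n := a n))"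
      using freeze_polys[OF v(1)] len carr \<open>n \<ge> 1\<close> by (metis atLeastAtMost_iff order_refl)
    obtain g' where g': "g' \<in> polys sg A n k"
      "\<And>z. eval_poly A g' z = eval3 A p (eval_poly A g z) (eval_poly A v z) (eval_poly A w z)"
      using eval3_polys[OF p g v(1) w(1)] by blast
    have "((select S a b)(n := y))(i := a i) = (select (S - {i}) a b)(n := y)" for S y
      using i by (auto simp: select_def fun_eq_iff)
    then have "eval_poly A v ((select S a b)(n := y)) = e g (S - {i}) y" for S y
      by (simp add: e_def v(2))
    moreover from this have "eval_poly A w ((select S a b)(n := y)) = e g (S - {i}) (a n)" for S y
      by (simp add: w(2))
    ultimately have "e g' S y = eval3 A p (e g S y) (e g (S - {i}) y) (e g (S - {i}) (a n))" for S y
      by (simp add: e_def g'(2))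
    with g'(1) show ?thesis by blast
  qed
  \<comment> \<open>The number \<open>m\<close> counts the blocks already treated: wherever one of them is set to \<open>a\<^sub>i\<close>, the
    premise holds modulo \<open>\<kappa>\<close>. Induction is on the number of blocks left to treat.\<close>
  have main: "(e g {1..<n} (a n), e g {1..<n} (b n)) \<in> \<gamma>"
    if "m < n" "g \<in> polys sg A n k" "\<And>S. S \<subset> {1..<n} \<Longrightarrow> (e g S (a n), e g S (b n)) \<in> \<gamma>"
      "\<And>S. \<not> {1..m} \<subseteq> S \<Longrightarrow> (e g S (a n), e g S (b n)) \<in> \<kappa>" for m g
    using that
  proof (induction "n - 1 - m" arbitrary: m g)
    case 0
    \<comment> \<open>All blocks are treated, and centrality modulo \<open>\<kappa>\<close> applies.\<close>
    then have m: "{1..m} = {1..<n}" by auto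
    have "(eval_poly A g (b(n := a n)), eval_poly A g b) \<in> \<kappa>"
    proof (rule centralizesD[OF \<kappa>(2) \<open>g \<in> polys sg A n k\<close> len ab])
      fix S assume "S \<subset> {1..<n}"
      then have "\<not> {1..m} \<subseteq> S" unfolding m by blast
      from 0(5)[OF this] show "(eval_poly A g ((select S a b)(n := a n)),
          eval_poly A g ((select S a b)(n := b n))) \<in> \<kappa>"
        by (simp only: e_def)
    qed
    then show ?case using top[OF \<open>g \<in> polys sg A n k\<close>] \<gamma>(2) by auto
  next
    case (Suc d)
    let ?i = "Suc m" and ?T = "{1..<n}" and ?U = "{1..<n} - {Suc m}"
    have i: "?i \<in> {1..<n}" using Suc.hyps(2) by auto
    note g = Suc.prems(2) and g\<gamma> = Suc.prems(3) and g\<kappa> = Suc.prems(4)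
    obtain g' where g': "g' \<in> polys sg A n k"
      and e: "\<And>S y. e g' S y = eval3 A p (e g S y) (e g (S - {?i}) y) (e g (S - {?i}) (a n))"
      using difference[OF g i] by blast
    have const: "(e g (S - {?i}) (a n), e g (S - {?i}) (a n)) \<in> \<delta>"
      if "\<delta> \<in> Con sg A" for S \<delta>
      using Con_refl[OF that] Con_carrier[OF assms(2) e_\<theta>[OF g, of "a n" "a n"]] by blast
    have "(e g' ?T (a n), e g' ?T (b n)) \<in> \<gamma>"
    proof (rule Suc.hyps(1)[of ?i])
      show "d = n - 1 - ?i" "?i < n" using Suc.hyps(2) by auto
      show "g' \<in> polys sg A n k" by fact
      show "(e g' S (a n), e g' S (b n)) \<in> \<gamma>" if "S \<subset> ?T" for S
        unfolding e using that
        by (intro eval3_congruent[OF \<gamma>(1) p] g\<gamma> const \<gamma>(1)) auto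
      show "(e g' S (a n), e g' S (b n)) \<in> \<kappa>" if S: "\<not> {1..?i} \<subseteq> S" for S
      proof (cases "?i \<in> S")
        case True
        \<comment> \<open>An earlier block is set to \<open>a\<^sub>j\<close>, both at \<open>S\<close> and at \<open>S - {?i}\<close>.\<close>
        with S have "\<not> {1..m} \<subseteq> S" by (auto simp: atLeastAtMostSuc_conv)
        then show ?thesis unfolding e
          by (intro eval3_congruent[OF \<kappa>(1) p] g\<kappa> const \<kappa>(1)) auto
      next
        case False
        \<comment> \<open>The first two arguments of \<open>p\<close> agree, and the third is independent of the last block.\<close>
        then have "S - {?i} = S" by simp
        then have "(e g' S y, e g S (a n)) \<in> \<kappa>" if "y \<in> {a n, b n}" for y
          unfolding e using malcev(2)[OF e_\<theta>[OF g, of "a n" y S S]] that by simp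
        from Con_common_right[OF \<kappa>(1) this this] show ?thesis by simp
      qed
    qed
    moreover have "(e g' ?T (a n), e g ?T (a n)) \<in> \<gamma>"
      unfolding e using malcev(1)[OF e_\<theta>[OF g, of "a n" "a n"]] \<gamma>(2) by auto
    moreover have "(e g' ?T (b n), e g ?T (b n)) \<in> \<gamma>"
    proof (rule Con_trans[OF \<gamma>(1)])
      \<comment> \<open>The premise at \<open>?U\<close> lets \<open>b\<^sub>n\<close> replace \<open>a\<^sub>n\<close> in the third argument.\<close>
      have refl: "(e g S (b n), e g S (b n)) \<in> \<gamma>" for S
        using Con_refl[OF \<gamma>(1)] Con_carrier[OF assms(2) e_\<theta>[OF g, of "b n" "b n"]] by blast
      have "?U \<subset> ?T" using i by blast
      then show "(e g' ?T (b n), eval3 A p (e g ?T (b n)) (e g ?U (b n)) (e g ?U (b n))) \<in> \<gamma>"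
        unfolding e by (intro eval3_congruent[OF \<gamma>(1) p] refl g\<gamma>)
      show "(eval3 A p (e g ?T (b n)) (e g ?U (b n)) (e g ?U (b n)), e g ?T (b n)) \<in> \<gamma>"
        using malcev(1)[OF e_\<theta>[OF g, of "b n" "b n"]] \<gamma>(2) by auto
    qed
    ultimately show ?case
      using Con_common_right[OF \<gamma>(1)] Con_sym[OF \<gamma>(1)] Con_trans[OF \<gamma>(1)] by meson
  qed
  have "(e g {1..<n} (a n), e g {1..<n} (b n)) \<in> \<gamma>"
    using main[of 0 g] g prem \<open>n \<ge> 1\<close> by simp
  then show "(eval_poly A g (b(n := a n)), eval_poly A g b) \<in> \<gamma>" using top[OF g] by simp
qed


section \<open>Quotient algebras\<close>

lemma carrier_quotient [simp]: "carrier (quotient_algebra A \<eta>) = carrier A // \<eta>"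
  by (simp add: quotient_algebra_def)

lemma in_listset_iff: "xs \<in> listset Xs \<longleftrightarrow> list_all2 (\<in>) xs Xs"
  by (induction Xs arbitrary: xs) (auto simp: set_Cons_def list_all2_Cons2)

lemma class_eq_iff:
  assumes "\<eta> \<in> Con sg A" "x \<in> carrier A" "y \<in> carrier A"
  shows "\<eta> `` {x} = \<eta> `` {y} \<longleftrightarrow> (x, y) \<in> \<eta>"
  using eq_equiv_class_iff[OF ConD(1)] assms by metis

text \<open>
  All members of the list of classes are interchangeable by compatibility of \<open>\<eta>\<close>, so the union
  in the definition of the quotient operation has equal members; it is nonempty because each
  class contains its representative.
\<close>

lemma interp_quotient:
  assumes \<eta>: "\<eta> \<in> Con sg A" and h: "sg h = Some (length us)" and us: "set us \<subseteq> carrier A"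
  shows "interp (quotient_algebra A \<eta>) h (map (\<lambda>x. \<eta> `` {x}) us) = \<eta> `` {interp A h us}"
proof -
  let ?L = "listset (map (\<lambda>x. \<eta> `` {x}) us)"
  have same: "\<eta> `` {interp A h xs} = \<eta> `` {interp A h us}" if "xs \<in> ?L" for xs
  proof -
    have "list_all2 (\<lambda>x y. (x, y) \<in> \<eta>) us xs"
      using that by (auto simp: in_listset_iff list_all2_conv_all_nth)
    then have "(interp A h us, interp A h xs) \<in> \<eta>" by (rule ConD(2)[OF \<eta> h])
    then show ?thesis using equiv_class_eq[OF ConD(1)[OF \<eta>]] by blast
  qed
  have "us \<in> ?L"
    using us Con_refl[OF \<eta>] by (auto simp: in_listset_iff list_all2_conv_all_nth subset_iff)
  then have "(\<Union>xs\<in>?L. \<eta> `` {interp A h xs}) = \<eta> `` {interp A h us}"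
    by (intro SUP_eq_const same) blast
  then show ?thesis by (simp add: quotient_algebra_def)
qed

lemma eval_quotient:
  assumes "\<eta> \<in> Con sg A" "wf_trm sg t" "\<And>x. x \<in> vars t \<Longrightarrow> \<rho> x \<in> carrier A"
  shows "eval (quotient_algebra A \<eta>) (\<lambda>x. \<eta> `` {\<rho> x}) t = \<eta> `` {eval A \<rho> t}"
  using assms(2,3)
proof (induction t)
  case (App h ts)
  have "map (eval (quotient_algebra A \<eta>) (\<lambda>x. \<eta> `` {\<rho> x})) ts
      = map (\<lambda>x. \<eta> `` {x}) (map (eval A \<rho>) ts)"
    using App by auto
  moreover have "set (map (eval A \<rho>) ts) \<subseteq> carrier A"
    using App.prems by (auto intro!: eval_closed[OF assms(1)])
  ultimately show ?case
    using interp_quotient[OF assms(1), of h "map (eval A \<rho>) ts"] App.prems(1)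
    by (simp del: map_map map_eq_conv)
qed simp

lemma eval_poly_quotient:
  assumes "\<eta> \<in> Con sg A" "g \<in> polys sg A n k"
    and "\<And>i. i \<in> {1..n} \<Longrightarrow> length (z i) = k i" "\<And>i. i \<in> {1..n} \<Longrightarrow> set (z i) \<subseteq> carrier A"
  shows "eval_poly (quotient_algebra A \<eta>) (map_vars (map_sum id (\<lambda>c. \<eta> `` {c})) g)
      (\<lambda>i. map (\<lambda>x. \<eta> `` {x}) (z i)) = \<eta> `` {eval_poly A g z}"
proof -
  let ?\<rho> = "case_sum (\<lambda>(i, j). z i ! j) (\<lambda>c. c)"
  have vars: "x \<in> Inl ` {(i, j). i \<in> {1..n} \<and> j < k i} \<union> Inr ` carrier A" if "x \<in> vars g" for x
    using assms(2) that by (auto simp: polys_def)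
  have wf: "wf_trm sg g" using assms(2) by (simp add: polys_def)
  have "eval (quotient_algebra A \<eta>) (\<lambda>x. \<eta> `` {?\<rho> x}) g = \<eta> `` {eval A ?\<rho> g}"
    by (rule eval_quotient[OF assms(1) wf], drule vars) (use assms(3,4) in \<open>auto simp: subset_iff\<close>)
  then show ?thesis unfolding eval_poly_def eval_map_vars
    by (subst eval_cong[of g _ "\<lambda>x. \<eta> `` {?\<rho> x}"], drule_tac vars) (auto simp: assms(3))
qed

lemma polys_quotient:
  assumes "g \<in> polys sg A n k"
  shows "map_vars (map_sum id (\<lambda>c. \<eta> `` {c})) g \<in> polys sg (quotient_algebra A \<eta>) n k"
proof -
  have "map_sum id (\<lambda>c. \<eta> `` {c}) x \<in>
      Inl ` {(i, j). i \<in> {1..n} \<and> j < k i} \<union> Inr ` (carrier A // \<eta>)"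
    if "x \<in> Inl ` {(i, j). i \<in> {1..n} \<and> j < k i} \<union> Inr ` carrier A" for x
    using that by (auto simp: quotientI)
  then have "map_sum id (\<lambda>c. \<eta> `` {c}) ` vars g \<subseteq>
      Inl ` {(i, j). i \<in> {1..n} \<and> j < k i} \<union> Inr ` (carrier A // \<eta>)"
    using assms unfolding polys_def by blast
  then show ?thesis using assms by (simp add: polys_def wf_map_vars vars_map_vars)
qed

text \<open>
  The relation \<open>\<delta>/\<eta>\<close> is given by some pair of representatives in \<open>\<delta>\<close>; since \<open>\<eta> \<subseteq> \<delta>\<close>, any pair
  of representatives serves.
\<close>

lemma quotient_con_class_iff:
  assumes "\<eta> \<in> Con sg A" "\<delta> \<in> Con sg A" "\<eta> \<subseteq> \<delta>" "x \<in> carrier A" "y \<in> carrier A"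
  shows "(\<eta> `` {x}, \<eta> `` {y}) \<in> quotient_con \<delta> \<eta> \<longleftrightarrow> (x, y) \<in> \<delta>"
proof
  assume "(\<eta> `` {x}, \<eta> `` {y}) \<in> quotient_con \<delta> \<eta>"
  then obtain u v where uv: "\<eta> `` {x} = \<eta> `` {u}" "\<eta> `` {y} = \<eta> `` {v}" "(u, v) \<in> \<delta>"
    by (auto simp: quotient_con_def)
  have "u \<in> carrier A" "v \<in> carrier A" using Con_carrier[OF assms(2) uv(3)] by auto
  then have "(x, u) \<in> \<delta>" "(y, v) \<in> \<delta>"
    using uv(1,2) class_eq_iff[OF assms(1)] assms(3-5) by auto
  then show "(x, y) \<in> \<delta>"
    using Con_common_right[OF assms(2) Con_trans[OF assms(2) _ uv(3)]] by simp
qed (auto simp: quotient_con_def)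

text \<open>
  The inverse of forming \<open>\<delta>/\<eta>\<close> in the correspondence between congruences above \<open>\<eta>\<close> and
  congruences of the quotient.
\<close>

definition comap_con :: "('f, 'a) algebra \<Rightarrow> 'a rel \<Rightarrow> 'a set rel \<Rightarrow> 'a rel" where
  "comap_con A \<eta> \<delta> = {(x, y) \<in> carrier A \<times> carrier A. (\<eta> `` {x}, \<eta> `` {y}) \<in> \<delta>}"

lemma comap_con_in_Con:
  assumes \<eta>: "\<eta> \<in> Con sg A" and \<delta>: "\<delta> \<in> Con sg (quotient_algebra A \<eta>)"
  shows "comap_con A \<eta> \<delta> \<in> Con sg A" (is "?\<delta> \<in> _")
proof -
  have "equiv (carrier A) ?\<delta>"
  proof (rule equivI)
    show "?\<delta> \<subseteq> carrier A \<times> carrier A" by (auto simp: comap_con_def)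
    show "refl_on (carrier A) ?\<delta>"
      using Con_refl[OF \<delta>] by (auto simp: comap_con_def quotientI intro!: refl_onI)
    show "sym ?\<delta>" using Con_sym[OF \<delta>] by (auto simp: comap_con_def intro!: symI)
    show "trans ?\<delta>" using Con_trans[OF \<delta>] by (auto simp: comap_con_def intro!: transI)
  qed
  moreover have "(interp A h xs, interp A h ys) \<in> ?\<delta>"
    if h: "sg h = Some (length xs)" and xy: "list_all2 (\<lambda>x y. (x, y) \<in> ?\<delta>) xs ys" for h xs ys
  proof -
    have xs: "set xs \<subseteq> carrier A" and ys: "set ys \<subseteq> carrier A" and "length ys = length xs"
      using xy by (auto simp: comap_con_def list_all2_conv_all_nth in_set_conv_nth)
    then have h': "sg h = Some (length ys)" using h by simp
    have "list_all2 (\<lambda>x y. (x, y) \<in> \<delta>) (map (\<lambda>x. \<eta> `` {x}) xs) (map (\<lambda>x. \<eta> `` {x}) ys)"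
      using xy by (auto simp: comap_con_def list_all2_conv_all_nth)
    from ConD(2)[OF \<delta> _ this, of h] have "(\<eta> `` {interp A h xs}, \<eta> `` {interp A h ys}) \<in> \<delta>"
      by (simp add: h interp_quotient[OF \<eta> h xs] interp_quotient[OF \<eta> h' ys])
    moreover have "interp A h zs \<in> carrier A" if "sg h = Some (length zs)" "set zs \<subseteq> carrier A" for zs
    proof -
      have "list_all2 (\<lambda>x y. (x, y) \<in> \<eta>) zs zs"
        using that(2) Con_refl[OF \<eta>] by (auto simp: list_all2_conv_all_nth subset_iff)
      from ConD(2)[OF \<eta> that(1) this] show ?thesis using Con_carrier[OF \<eta>] by blast
    qed
    ultimately show ?thesis using h h' xs ys by (simp add: comap_con_def)
  qed
  ultimately show ?thesis by (auto simp: Con_def)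
qed

lemma subset_comap_con:
  assumes "\<eta> \<in> Con sg A" "\<delta> \<in> Con sg (quotient_algebra A \<eta>)"
  shows "\<eta> \<subseteq> comap_con A \<eta> \<delta>"
proof (rule subrelI)
  fix x y assume xy: "(x, y) \<in> \<eta>"
  then have c: "x \<in> carrier A" "y \<in> carrier A" using Con_carrier[OF assms(1)] by auto
  with xy have "\<eta> `` {x} = \<eta> `` {y}" using class_eq_iff[OF assms(1)] by blast
  moreover have "(\<eta> `` {x}, \<eta> `` {x}) \<in> \<delta>"
    using Con_refl[OF assms(2)] c by (simp add: quotientI)
  ultimately show "(x, y) \<in> comap_con A \<eta> \<delta>" using c by (simp add: comap_con_def)
qed

lemma quotient_comap_con:
  assumes "\<delta> \<in> Con sg (quotient_algebra A \<eta>)"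
  shows "quotient_con (comap_con A \<eta> \<delta>) \<eta> = \<delta>"
proof
  show "\<delta> \<subseteq> quotient_con (comap_con A \<eta> \<delta>) \<eta>"
  proof (rule subrelI)
    fix X Y assume "(X, Y) \<in> \<delta>"
    moreover from this have "X \<in> carrier A // \<eta>" "Y \<in> carrier A // \<eta>"
      using Con_carrier[OF assms] by auto
    ultimately show "(X, Y) \<in> quotient_con (comap_con A \<eta> \<delta>) \<eta>"
      by (fastforce simp: quotient_con_def comap_con_def elim!: quotientE)
  qed
qed (auto simp: quotient_con_def comap_con_def)

lemma quotient_con_in_Con:
  assumes \<eta>: "\<eta> \<in> Con sg A" and \<delta>: "\<delta> \<in> Con sg A" and sub: "\<eta> \<subseteq> \<delta>"
  shows "quotient_con \<delta> \<eta> \<in> Con sg (quotient_algebra A \<eta>)" (is "?Q \<in> _")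
proof -
  note class_iff = quotient_con_class_iff[OF \<eta> \<delta> sub]
  have sub': "?Q \<subseteq> (carrier A // \<eta>) \<times> (carrier A // \<eta>)"
    using Con_carrier[OF \<delta>] by (auto simp: quotient_con_def quotientI)
  have "equiv (carrier A // \<eta>) ?Q"
  proof (rule equivI)
    show "?Q \<subseteq> (carrier A // \<eta>) \<times> (carrier A // \<eta>)" by fact
    show "refl_on (carrier A // \<eta>) ?Q"
      using Con_refl[OF \<delta>] class_iff by (auto intro!: refl_onI elim!: quotientE)
    show "sym ?Q" using Con_sym[OF \<delta>] by (auto simp: quotient_con_def intro!: symI)
    show "trans ?Q"
    proof (rule transI)
      fix X Y Z assume XYZ: "(X, Y) \<in> ?Q" "(Y, Z) \<in> ?Q"
      then obtain x y z where "x \<in> carrier A" "y \<in> carrier A" "z \<in> carrier A"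
        "X = \<eta> `` {x}" "Y = \<eta> `` {y}" "Z = \<eta> `` {z}"
        using sub' by (blast elim!: quotientE)
      with XYZ show "(X, Z) \<in> ?Q" using class_iff Con_trans[OF \<delta>] by metis
    qed
  qed
  moreover have "(interp (quotient_algebra A \<eta>) h Xs, interp (quotient_algebra A \<eta>) h Ys) \<in> ?Q"
    if h: "sg h = Some (length Xs)" and XY: "list_all2 (\<lambda>X Y. (X, Y) \<in> ?Q) Xs Ys" for h Xs Ys
  proof -
    have "\<forall>i. \<exists>u. i < length Xs \<longrightarrow>
        u \<in> \<delta> \<and> Xs ! i = \<eta> `` {fst u} \<and> Ys ! i = \<eta> `` {snd u}"
      using XY by (fastforce simp: list_all2_conv_all_nth quotient_con_def)
    then obtain u where u: "\<And>i. i < length Xs \<Longrightarrow>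
        u i \<in> \<delta> \<and> Xs ! i = \<eta> `` {fst (u i)} \<and> Ys ! i = \<eta> `` {snd (u i)}" by metis
    define xs ys where "xs = map (fst \<circ> u) [0..<length Xs]" and "ys = map (snd \<circ> u) [0..<length Xs]"
    have Xs: "Xs = map (\<lambda>x. \<eta> `` {x}) xs" and Ys: "Ys = map (\<lambda>x. \<eta> `` {x}) ys"
      using u list_all2_lengthD[OF XY] by (auto simp: xs_def ys_def intro!: nth_equalityI)
    have "list_all2 (\<lambda>x y. (x, y) \<in> \<delta>) xs ys"
      using u by (auto simp: list_all2_conv_all_nth xs_def ys_def)
    moreover have h': "sg h = Some (length xs)" "sg h = Some (length ys)"
      using h by (auto simp: xs_def ys_def)
    ultimately have "(interp A h xs, interp A h ys) \<in> \<delta>" "set xs \<subseteq> carrier A" "set ys \<subseteq> carrier A"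
      using ConD(2)[OF \<delta>] Con_lists_carrier[OF \<delta>] by blast+
    then show ?thesis
      unfolding Xs Ys interp_quotient[OF \<eta> h'(1) \<open>set xs \<subseteq> carrier A\<close>]
        interp_quotient[OF \<eta> h'(2) \<open>set ys \<subseteq> carrier A\<close>]
      by (auto simp: quotient_con_def)
  qed
  ultimately show ?thesis by (auto simp: Con_def)
qed

text \<open>
  Only the constants of a polynomial over the quotient have to be lifted, each to a chosen
  representative of its class.
\<close>

lemma polys_quotient_lift:
  assumes "\<eta> \<in> Con sg A" "g \<in> polys sg (quotient_algebra A \<eta>) n k"
  obtains g' where "g' \<in> polys sg A n k" "map_vars (map_sum id (\<lambda>c. \<eta> `` {c})) g' = g"
proof
  let ?r = "\<lambda>X. SOME x. x \<in> X"
  let ?g = "map_vars (map_sum id ?r) g"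
  have r: "?r X \<in> carrier A \<and> \<eta> `` {?r X} = X" if "X \<in> carrier A // \<eta>" for X
  proof -
    obtain x where x: "x \<in> carrier A" "X = \<eta> `` {x}" using \<open>X \<in> carrier A // \<eta>\<close> by (rule quotientE)
    then have "x \<in> X" using Con_refl[OF assms(1)] by blast
    then have "?r X \<in> X" by (rule someI)
    then have "(x, ?r X) \<in> \<eta>" using x by blast
    moreover from this have "?r X \<in> carrier A" using Con_carrier[OF assms(1)] by blast
    ultimately show ?thesis using class_eq_iff[OF assms(1)] x by blast
  qed
  have vars: "x \<in> Inl ` {(i, j). i \<in> {1..n} \<and> j < k i} \<union> Inr ` (carrier A // \<eta>)"
    if "x \<in> vars g" for x
    using assms(2) that by (auto simp: polys_def)
  have "map_sum id ?r x \<in> Inl ` {(i, j). i \<in> {1..n} \<and> j < k i} \<union> Inr ` carrier A"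
    if "x \<in> vars g" for x
    using vars[OF that] r by auto
  then show "?g \<in> polys sg A n k"
    using assms(2) unfolding polys_def by (auto simp: wf_map_vars vars_map_vars)
  have "map_sum id (\<lambda>c. \<eta> `` {c}) (map_sum id ?r x) = x" if "x \<in> vars g" for x
    using vars[OF that] r by auto
  then show "map_vars (map_sum id (\<lambda>c. \<eta> `` {c})) ?g = g"
    by (simp add: subst_subst subst_Var)
qed

text \<open>
  Values of corresponding polynomials at corresponding tuples are \<open>\<delta>/\<eta>\<close>-related in the quotient
  exactly when they are \<open>\<delta>\<close>-related upstairs. An instance of the condition in \<open>A\<close> maps to one in
  the quotient, and an instance in the quotient comes from one in \<open>A\<close>: a pair of
  \<open>\<alpha>\<^sub>i/\<eta>\<close>-related classes has \<open>\<alpha>\<^sub>i\<close>-related representatives, which are chosen simultaneously for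
  both tuples.
\<close>

lemma centralizes_quotient_iff:
  assumes \<eta>: "\<eta> \<in> Con sg A" and "n \<ge> 1"
    and \<alpha>: "\<And>i. i \<in> {1..n} \<Longrightarrow> \<alpha> i \<in> Con sg A"
    and \<delta>: "\<delta> \<in> Con sg A" "\<eta> \<subseteq> \<delta>"
  shows "centralizes sg (quotient_algebra A \<eta>) n (\<lambda>i. quotient_con (\<alpha> i) \<eta>) (quotient_con \<delta> \<eta>)
    \<longleftrightarrow> centralizes sg A n \<alpha> \<delta>"
proof -
  let ?q = "\<lambda>x. \<eta> `` {x}" and ?B = "quotient_algebra A \<eta>"
  let ?lift = "\<lambda>g. map_vars (map_sum id ?q) g"
  have transfer: "(eval_poly ?B (?lift g) (\<lambda>i. map ?q (z i)), eval_poly ?B (?lift g) (\<lambda>i. map ?q (w i)))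
      \<in> quotient_con \<delta> \<eta> \<longleftrightarrow> (eval_poly A g z, eval_poly A g w) \<in> \<delta>"
    if g: "g \<in> polys sg A n k"
      and z: "\<And>i. i \<in> {1..n} \<Longrightarrow> length (z i) = k i \<and> set (z i) \<subseteq> carrier A"
      and w: "\<And>i. i \<in> {1..n} \<Longrightarrow> length (w i) = k i \<and> set (w i) \<subseteq> carrier A" for g k z w
  proof -
    have closed: "eval_poly A g z \<in> carrier A"
      if "\<And>i. i \<in> {1..n} \<Longrightarrow> length (z i) = k i \<and> set (z i) \<subseteq> carrier A" for z
    proof -
      have "(eval_poly A g z, eval_poly A g z) \<in> \<eta>"
        using that Con_refl[OF \<eta>]
        by (intro eval_poly_congruent[OF \<eta> g]) (force simp: list_all2_conv_all_nth)+
      then show ?thesis using Con_carrier[OF \<eta>] by blast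
    qed
    have "eval_poly ?B (?lift g) (\<lambda>i. map ?q (z i)) = ?q (eval_poly A g z)"
      "eval_poly ?B (?lift g) (\<lambda>i. map ?q (w i)) = ?q (eval_poly A g w)"
      using z w by (intro eval_poly_quotient[OF \<eta> g]; simp)+
    then show ?thesis using quotient_con_class_iff[OF \<eta> \<delta> closed[OF z] closed[OF w]] by simp
  qed
  have shift: "(\<lambda>i. map ?q (((select S a b)(n := y)) i))
      = (select S (\<lambda>i. map ?q (a i)) (\<lambda>i. map ?q (b i)))(n := map ?q y)" for S a b y
    by (auto simp: select_def fun_eq_iff)
  have shift': "(\<lambda>i. map ?q ((b(n := y)) i)) = (\<lambda>i. map ?q (b i))(n := map ?q y)" for b y
    by (auto simp: fun_eq_iff)
  show ?thesis
  proof
    assume C: "centralizes sg ?B n (\<lambda>i. quotient_con (\<alpha> i) \<eta>) (quotient_con \<delta> \<eta>)"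
    show "centralizes sg A n \<alpha> \<delta>"
    proof (rule centralizesI)
      fix k g a b
      assume g: "g \<in> polys sg A n k" and len: "\<And>i. i \<in> {1..n} \<Longrightarrow> length (a i) = k i"
        and len_b: "\<And>i. i \<in> {1..n} \<Longrightarrow> length (b i) = k i"
        and ab: "\<And>i. i \<in> {1..n} \<Longrightarrow> list_all2 (\<lambda>x y. (x, y) \<in> \<alpha> i) (a i) (b i)"
        and prem: "\<And>S. S \<subset> {1..<n} \<Longrightarrow> (eval_poly A g ((select S a b)(n := a n)),
            eval_poly A g ((select S a b)(n := b n))) \<in> \<delta>"
      have carr: "set (a i) \<subseteq> carrier A \<and> set (b i) \<subseteq> carrier A" if "i \<in> {1..n}" for i
        using Con_lists_carrier[OF \<alpha>[OF that] ab[OF that]] by blast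
      have "(eval_poly ?B (?lift g) ((\<lambda>i. map ?q (b i))(n := map ?q (a n))),
          eval_poly ?B (?lift g) (\<lambda>i. map ?q (b i))) \<in> quotient_con \<delta> \<eta>"
      proof (rule centralizesD[OF C polys_quotient[OF g]])
        fix i assume i: "i \<in> {1..n}"
        show "length (map ?q (a i)) = k i" using len[OF i] by simp
        show "list_all2 (\<lambda>x y. (x, y) \<in> quotient_con (\<alpha> i) \<eta>) (map ?q (a i)) (map ?q (b i))"
          unfolding list.rel_map using ab[OF i]
          by (rule list_all2_mono) (auto simp: quotient_con_def)
      next
        fix S assume "S \<subset> {1..<n}"
        from prem[OF this]
        show "(eval_poly ?B (?lift g) ((select S (\<lambda>i. map ?q (a i)) (\<lambda>i. map ?q (b i)))(n := map ?q (a n))),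
          eval_poly ?B (?lift g) ((select S (\<lambda>i. map ?q (a i)) (\<lambda>i. map ?q (b i)))(n := map ?q (b n))))
            \<in> quotient_con \<delta> \<eta>"
          unfolding shift[symmetric]
          by (subst transfer[OF g]) (use len len_b carr in \<open>auto simp: select_def\<close>)
      qed
      then show "(eval_poly A g (b(n := a n)), eval_poly A g b) \<in> \<delta>"
        unfolding shift'[symmetric]
        by (subst (asm) transfer[OF g]) (use len len_b carr in \<open>auto\<close>)
    qed
  next
    assume C: "centralizes sg A n \<alpha> \<delta>"
    show "centralizes sg ?B n (\<lambda>i. quotient_con (\<alpha> i) \<eta>) (quotient_con \<delta> \<eta>)"
    proof (rule centralizesI)
      fix k G a b
      assume G: "G \<in> polys sg ?B n k" and len: "\<And>i. i \<in> {1..n} \<Longrightarrow> length (a i) = k i"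
        and len_b: "\<And>i. i \<in> {1..n} \<Longrightarrow> length (b i) = k i"
        and ab: "\<And>i. i \<in> {1..n} \<Longrightarrow>
          list_all2 (\<lambda>x y. (x, y) \<in> quotient_con (\<alpha> i) \<eta>) (a i) (b i)"
        and prem: "\<And>S. S \<subset> {1..<n} \<Longrightarrow> (eval_poly ?B G ((select S a b)(n := a n)),
            eval_poly ?B G ((select S a b)(n := b n))) \<in> quotient_con \<delta> \<eta>"
      obtain g where g: "g \<in> polys sg A n k" and lift: "?lift g = G"
        using polys_quotient_lift[OF \<eta> G] by blast
      have "\<forall>i j. \<exists>u. i \<in> {1..n} \<longrightarrow> j < k i \<longrightarrow>
          u \<in> \<alpha> i \<and> a i ! j = ?q (fst u) \<and> b i ! j = ?q (snd u)"
        using ab len by (fastforce simp: list_all2_conv_all_nth quotient_con_def)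
      \<comment> \<open>\<open>u i j\<close> is a pair of representatives of the \<open>j\<close>-th entries of \<open>a i\<close> and \<open>b i\<close>.\<close>
      then obtain u where u: "\<And>i j. i \<in> {1..n} \<Longrightarrow> j < k i \<Longrightarrow>
          u i j \<in> \<alpha> i \<and> a i ! j = ?q (fst (u i j)) \<and> b i ! j = ?q (snd (u i j))" by metis
      define a' b' where "a' i = map (\<lambda>j. fst (u i j)) [0..<k i]"
        and "b' i = map (\<lambda>j. snd (u i j)) [0..<k i]" for i
      have qa: "map ?q (a' i) = a i" and qb: "map ?q (b' i) = b i" if "i \<in> {1..n}" for i
        using u[OF that] len[OF that] len_b[OF that]
        by (auto simp: a'_def b'_def intro!: nth_equalityI)
      have ab': "list_all2 (\<lambda>x y. (x, y) \<in> \<alpha> i) (a' i) (b' i)" if "i \<in> {1..n}" for i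
        using u[OF that] by (auto simp: a'_def b'_def list_all2_conv_all_nth)
      have len': "length (a' i) = k i" "length (b' i) = k i" for i
        by (auto simp: a'_def b'_def)
      have carr: "set (a' i) \<subseteq> carrier A \<and> set (b' i) \<subseteq> carrier A" if "i \<in> {1..n}" for i
        using Con_lists_carrier[OF \<alpha>[OF that] ab'[OF that]] by blast
      have n: "n \<in> {1..n}" using \<open>n \<ge> 1\<close> by simp
      have "(eval_poly A g (b'(n := a' n)), eval_poly A g b') \<in> \<delta>"
      proof (rule centralizesD[OF C g len'(1) ab'])
        fix S assume "S \<subset> {1..<n}"
        have "eval_poly ?B G ((select S a b)(n := map ?q y))
            = eval_poly ?B (?lift g) (\<lambda>i. map ?q (((select S a' b')(n := y)) i))" for y
          unfolding lift by (rule eval_poly_cong[OF G]) (auto simp: select_def qa qb)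
        from this[of "a' n"] this[of "b' n"] prem[OF \<open>S \<subset> {1..<n}\<close>]
        show "(eval_poly A g ((select S a' b')(n := a' n)),
            eval_poly A g ((select S a' b')(n := b' n))) \<in> \<delta>"
          unfolding qa[OF n] qb[OF n]
          by (subst transfer[OF g, symmetric]) (use len' carr in \<open>auto simp: select_def\<close>)
      qed
      moreover have "eval_poly ?B G (b(n := a n))
          = eval_poly ?B (?lift g) (\<lambda>i. map ?q ((b'(n := a' n)) i))"
        "eval_poly ?B G b = eval_poly ?B (?lift g) (\<lambda>i. map ?q (b' i))"
        unfolding lift by (rule eval_poly_cong[OF G]; auto simp: qa qb)+
      ultimately show "(eval_poly ?B G (b(n := a n)), eval_poly ?B G b) \<in> quotient_con \<delta> \<eta>"
        using transfer[OF g, of "b'(n := a' n)" b'] len' carr by auto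
    qed
  qed
qed


section \<open>Commutators above a weak Mal'cev term\<close>

theorem theorem5p10:
  fixes sg :: "'f \<rightharpoonup> nat"
    and V :: "('f, 'a) algebra set"
    and f :: "('f, 'a) algebra \<Rightarrow> 'a rel \<Rightarrow> 'a rel"
    and p :: "(nat, 'f) trm"
    and A :: "('f, 'a) algebra"
    and n :: nat
    and \<theta> :: "'a rel"
    and \<theta>s :: "nat \<Rightarrow> 'a rel"
  assumes "variety sg V"
    and "variety_weak_term sg V f p"
    and "A \<in> V"
    and "n \<ge> 2"
    and "\<theta> \<in> Con sg A"
    and "\<forall>i\<in>{1..n}. \<theta>s i \<in> Con sg A"
    and "f A \<theta> \<subseteq> commutator sg A n \<theta>s"
    and "commutator sg A n \<theta>s \<subseteq> con_join sg A (\<theta>s ` {1..n})"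
    and "con_join sg A (\<theta>s ` {1..n}) \<subseteq> \<theta>"
  shows "(\<forall>\<gamma>\<in>Con sg A. centralizes sg A n \<theta>s \<gamma> \<longleftrightarrow> commutator sg A n \<theta>s \<subseteq> \<gamma>) \<and>
         (\<forall>\<eta>\<in>Con sg A. \<eta> \<subseteq> (\<Inter>i\<in>{1..n}. \<theta>s i) \<longrightarrow>
            commutator sg (quotient_algebra A \<eta>) n (\<lambda>i. quotient_con (\<theta>s i) \<eta>)
            = quotient_con (con_join sg A {commutator sg A n \<theta>s, \<eta>}) \<eta>)"
proof -
  have alg: "is_algebra sg A" using assms(1,3) by (auto simp: variety_def models_def)
  let ?\<kappa> = "commutator sg A n \<theta>s"
  have \<theta>s: "\<And>i. i \<in> {1..n} \<Longrightarrow> \<theta>s i \<in> Con sg A" using assms(6) by blast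
  have \<kappa>: "?\<kappa> \<in> Con sg A" "centralizes sg A n \<theta>s ?\<kappa>"
    by (rule commutator_in_Con[OF alg \<theta>s] commutator_centralizes[OF alg \<theta>s]; assumption)+
  have n: "n \<ge> 1" using \<open>n \<ge> 2\<close> by simp
  have below: "\<theta>s i \<subseteq> \<theta>" if "i \<in> {1..n}" for i
    using assms(9) that by (fastforce simp: con_join_def)
  have "weak_term sg A (f A) p" using assms(2,3) by (simp add: variety_weak_term_def)
  then have p: "wf_trm sg p" "vars p \<subseteq> {0, 1, 2}"
    and "\<forall>(x, y)\<in>\<theta>. (eval3 A p x y y, x) \<in> f A \<theta> \<and> (x, eval3 A p y y x) \<in> f A \<theta>"
    using assms(5) unfolding weak_term_def by blast+
  then have malcev: "(eval3 A p x y y, x) \<in> ?\<kappa>" "(eval3 A p y y x, x) \<in> ?\<kappa>"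
    if "(x, y) \<in> \<theta>" for x y
    using that assms(7) Con_sym[OF \<kappa>(1)] by auto
  have one: "centralizes sg A n \<theta>s \<gamma> \<longleftrightarrow> ?\<kappa> \<subseteq> \<gamma>" if "\<gamma> \<in> Con sg A" for \<gamma>
  proof
    show "?\<kappa> \<subseteq> \<gamma>" if "centralizes sg A n \<theta>s \<gamma>"
      by (rule commutator_least[OF alg \<theta>s \<open>\<gamma> \<in> Con sg A\<close> that])
    show "centralizes sg A n \<theta>s \<gamma>" if "?\<kappa> \<subseteq> \<gamma>"
      by (rule centralizes_mono[OF n assms(5) below p malcev \<kappa> \<open>\<gamma> \<in> Con sg A\<close> that])
  qed
  have two: "commutator sg (quotient_algebra A \<eta>) n (\<lambda>i. quotient_con (\<theta>s i) \<eta>)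
      = quotient_con (con_join sg A {?\<kappa>, \<eta>}) \<eta>"
    if \<eta>: "\<eta> \<in> Con sg A" for \<eta>
  proof -
    let ?J = "con_join sg A {?\<kappa>, \<eta>}"
    have J: "?J \<in> Con sg A" "\<eta> \<subseteq> ?J" "?\<kappa> \<subseteq> ?J"
      using con_join_in_Con[OF alg, of "{?\<kappa>, \<eta>}"] \<eta> \<kappa>(1) by (auto simp: con_join_def)
    have C: "centralizes sg (quotient_algebra A \<eta>) n (\<lambda>i. quotient_con (\<theta>s i) \<eta>) (quotient_con \<delta> \<eta>)
        \<longleftrightarrow> ?\<kappa> \<subseteq> \<delta>" if "\<delta> \<in> Con sg A" "\<eta> \<subseteq> \<delta>" for \<delta>
      using centralizes_quotient_iff[OF \<eta> n \<theta>s that] one[OF that(1)] by simp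
    show ?thesis unfolding commutator_def[of sg "quotient_algebra A \<eta>"]
    proof (rule Least_equality)
      show "quotient_con ?J \<eta> \<in> Con sg (quotient_algebra A \<eta>) \<and>
          centralizes sg (quotient_algebra A \<eta>) n (\<lambda>i. quotient_con (\<theta>s i) \<eta>) (quotient_con ?J \<eta>)"
        using quotient_con_in_Con[OF \<eta> J(1,2)] C[OF J(1,2)] J(3) by blast
    next
      fix \<delta> assume \<delta>: "\<delta> \<in> Con sg (quotient_algebra A \<eta>) \<and>
          centralizes sg (quotient_algebra A \<eta>) n (\<lambda>i. quotient_con (\<theta>s i) \<eta>) \<delta>"
      let ?\<delta> = "comap_con A \<eta> \<delta>"
      have \<delta>': "?\<delta> \<in> Con sg A" "\<eta> \<subseteq> ?\<delta>" "quotient_con ?\<delta> \<eta> = \<delta>"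
        using \<delta> comap_con_in_Con[OF \<eta>] subset_comap_con[OF \<eta>] quotient_comap_con by blast+
      then have "?\<kappa> \<subseteq> ?\<delta>" using C[OF \<delta>'(1,2)] \<delta> by simp
      then have "?J \<subseteq> ?\<delta>" using \<delta>'(1,2) by (auto simp: con_join_def)
      then have "quotient_con ?J \<eta> \<subseteq> quotient_con ?\<delta> \<eta>" by (auto simp: quotient_con_def)
      then show "quotient_con ?J \<eta> \<subseteq> \<delta>" using \<delta>'(3) by simp
    qed
  qed
  show ?thesis using one two by blast
qed

end
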